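(* Let $n\geq 1$ be an integer, let $q\geq 1$ be a real number, let $a<b$ be real numbers, and let $f:[a,b]\to\mathbb{R}$ be $n$-times differentiable on $[a,b]$ with $f^{(n)}\in L[a,b]$. If $|f^{(n)}|^q$ is convex on $[a,b]$, then for all $x\in[a,b]$ $$\left|\int_a^b f(t)\,dt-\sum_{k=0}^{n-1}\left[\frac{(b-x)^{k+1}+(-1)^k(x-a)^{k+1}}{(k+1)!}\right]f^{(k)}(x)\right|$$ $$\leq \frac{1}{(n+1)!(b-a)^{1/q}(n+2)^{1/q}}\left\{(x-a)^{n+1}\Big[\left[(n+2)(b-x)+(x-a)\right]|f^{(n)}(a)|^q+(n+1)(x-a)|f^{(n)}(b)|^q\Big]^{1/q}+(b-x)^{n+1}\Big[(n+1)(b-x)|f^{(n)}(a)|^q+\left[(n+2)(x-a)+(b-x)\right]|f^{(n)}(b)|^q\Big]^{1/q}\right\}.$$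
   Context: $f^{(k)}$ denotes the $k$-th derivative of $f$ (one-sided at the endpoints), with $f^{(0)}=f$; $L[a,b]$ is the space of Lebesgue integrable functions on $[a,b]$. *)

theory Defs
  imports "HOL-Analysis.Analysis"
begin

(* Differentiating within S makes the derivatives one-sided at the endpoints when S = {a..b}.
   The iterated deriv operator would be two-sided there and would involve values of f
   outside [a,b]. *)
primrec nth_deriv_within :: "real set \<Rightarrow> nat \<Rightarrow> (real \<Rightarrow> real) \<Rightarrow> real \<Rightarrow> real" where
  "nth_deriv_within S 0 f = f"
| "nth_deriv_within S (Suc k) f =
     (\<lambda>x. vector_derivative (nth_deriv_within S k f) (at x within S))"

definition times_differentiable_on :: "nat \<Rightarrow> (real \<Rightarrow> real) \<Rightarrow> real set \<Rightarrow> bool" where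
  "times_differentiable_on n f S \<longleftrightarrow> (\<forall>k<n. nth_deriv_within S k f differentiable_on S)"

end

theory Submission
  imports Defs
begin

text \<open>
  Repeated integration by parts, anchored at an endpoint $c$ of an interval, is condensed into one
  explicit function: the sum $T_c(t) = \sum_{k<n} (-1)^k (t-c)^{k+1} f^{(k)}(t) / (k+1)!$ has the
  telescoping derivative $f(t) - (-1)^n (t-c)^n f^{(n)}(t)/n!$ and vanishes at $c$.  Anchoring at
  $a$ on $[a,x]$ and at $b$ on $[x,b]$, the difference $T_a(x) - T_b(x)$ is the sum in the
  theorem, so the error is at most the sum of $\int |t-c|^n |f^{(n)}(t)| / n!$ over the two sides
  (\<open>has_real_derivative_anchored_taylor_sum\<close>).  The Henstock--Kurzweil
  form of the fundamental theorem asks only for a derivative of $T_c$ at every point, so continuity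
  of $f^{(n)}$ need not be established first.

  Convexity puts $|f^{(n)}|^q$ below its chord, so $|f^{(n)}| \le h^{1/q}$ with $h$ affine
  (\<open>powr_bounded_by_chord\<close>).  Jensen's inequality for the concave function $y \mapsto y^{1/q}$ and
  the weight $|t-c|^n$ then replaces $h$ by its weighted mean (\<open>integral_powr_mean_le\<close>).  For an
  affine $h$ this mean is the value at the centroid of the weight, $(h(c) + (n+1) h(d))/(n+2)$ with
  $d$ the other endpoint (\<open>endpoint_power_moment_affine\<close>).  With $c = a$ and $c = b$, $d = x$,
  these two values are the two brackets of the bound, divided by $(b-a)(n+2)$.
\<close>

section \<open>An antiderivative for iterated integration by parts\<close>

lemma nth_deriv_within_has_real_derivative:
  assumes "times_differentiable_on n f S" "k < n" "t \<in> S"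
  shows "(nth_deriv_within S k f has_real_derivative nth_deriv_within S (Suc k) f t) (at t within S)"
proof -
  have "nth_deriv_within S k f differentiable (at t within S)"
    using assms by (auto simp: times_differentiable_on_def differentiable_on_def)
  then show ?thesis
    by (simp add: vector_derivative_works has_real_derivative_iff_has_vector_derivative)
qed

definition anchored_taylor_sum :: "(nat \<Rightarrow> real \<Rightarrow> real) \<Rightarrow> nat \<Rightarrow> real \<Rightarrow> real \<Rightarrow> real" where
  "anchored_taylor_sum D n c t =
     (\<Sum>k<n. (- 1) ^ k * ((t - c) ^ (k + 1) / fact (k + 1)) * D k t)"

lemma anchored_taylor_sum_at_anchor [simp]: "anchored_taylor_sum D n c c = 0"
  by (simp add: anchored_taylor_sum_def)

text \<open>
  By the product rule, the alternating sign makes the term with \<open>D (k + 1)\<close> coming from summand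
  \<open>k\<close> cancel the one coming from summand \<open>k + 1\<close>; only the two ends of the sum survive.
\<close>

lemma has_real_derivative_anchored_taylor_sum:
  assumes "\<And>k. k < n \<Longrightarrow> (D k has_real_derivative D (Suc k) t) (at t within S)"
  shows "(anchored_taylor_sum D n c has_real_derivative
           D 0 t - (- 1) ^ n * ((t - c) ^ n / fact n) * D n t) (at t within S)"
  using assms
proof (induction n)
  case 0
  then show ?case by (simp add: anchored_taylor_sum_def[abs_def])
next
  case (Suc n)
  have pw: "((\<lambda>t. (t - c) ^ (n + 1) / fact (n + 1)) has_real_derivative (t - c) ^ n / fact n)
      (at t within S)"
    by (rule derivative_eq_intros refl | simp add: divide_simps)+
  have "((\<lambda>t. (- 1) ^ n * ((t - c) ^ (n + 1) / fact (n + 1)) * D n t) has_real_derivative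
      (- 1) ^ n * ((t - c) ^ n / fact n) * D n t
      + (- 1) ^ n * ((t - c) ^ (n + 1) / fact (n + 1)) * D (Suc n) t) (at t within S)"
    using DERIV_mult[OF DERIV_cmult[OF pw, of "(- 1) ^ n"] Suc.prems[of n]]
    by (simp add: algebra_simps)
  moreover have "(anchored_taylor_sum D n c has_real_derivative
           D 0 t - (- 1) ^ n * ((t - c) ^ n / fact n) * D n t) (at t within S)"
    by (rule Suc.IH) (simp add: Suc.prems)
  moreover have "anchored_taylor_sum D (Suc n) c = (\<lambda>t. anchored_taylor_sum D n c t +
      (- 1) ^ n * ((t - c) ^ (n + 1) / fact (n + 1)) * D n t)"
    by (simp add: anchored_taylor_sum_def fun_eq_iff)
  ultimately show ?case
    by (auto intro: DERIV_add[THEN DERIV_cong])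
qed

section \<open>Jensen's inequality for a concave power\<close>

text \<open>
  The right-hand side is the tangent to \<open>y powr p\<close> at \<open>m\<close>.  After dividing by \<open>m powr p\<close>, with
  $r = y/m > 0$, the claim is convexity of \<open>exp\<close> between \<open>0\<close> and \<open>ln r\<close>.
\<close>

lemma powr_le_tangent:
  fixes y m p :: real
  assumes "0 \<le> y" "0 < m" "0 \<le> p" "p \<le> 1"
  shows "y powr p \<le> m powr p * (1 - p + p * (y / m))"
proof (cases "y = 0")
  case True
  then show ?thesis using assms by simp
next
  case False
  define r where "r = y / m"
  have r: "r > 0" using assms False by (simp add: r_def)
  have "r powr p \<le> 1 - p + p * r"
    using convex_onD[OF exp_convex, of p 0 "ln r"] assms r by (simp add: powr_def)
  moreover have "y powr p = m powr p * r powr p"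
    using assms r by (simp add: r_def powr_mult[symmetric])
  ultimately show ?thesis
    using mult_left_mono[of "r powr p" "1 - p + p * r" "m powr p"] by (simp add: r_def[symmetric])
qed

text \<open>
  Here \<open>M\<close> is the mean of \<open>h\<close> for the weight \<open>w\<close>.  The tangent at \<open>M\<close> bounds the integrand, and
  integrating the weighted tangent gives \<open>W\<close> times its value at \<open>M\<close>.  The mean enters through the
  product \<open>W * M\<close> rather than a quotient, so that the inequality also makes sense on a degenerate
  interval, where \<open>W = 0\<close>.
\<close>

lemma integral_powr_mean_le:
  fixes w h :: "real \<Rightarrow> real"
  assumes w: "continuous_on {u..v} w" "\<And>t. t \<in> {u..v} \<Longrightarrow> 0 \<le> w t"
    and h: "continuous_on {u..v} h" "\<And>t. t \<in> {u..v} \<Longrightarrow> 0 \<le> h t"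
    and p: "0 < p" "p \<le> 1"
    and W: "(w has_integral W) {u..v}" and M: "((\<lambda>t. w t * h t) has_integral W * M) {u..v}"
    and "0 \<le> M"
  shows "integral {u..v} (\<lambda>t. w t * h t powr p) \<le> W * M powr p"
proof (cases "W * M = 0")
  case True
  \<comment> \<open>There is no tangent at \<open>M = 0\<close>, but a continuous \<open>w * h \<ge> 0\<close> with integral \<open>0\<close>
    vanishes identically.\<close>
  have wh: "w t * h t = 0" if "t \<in> {u..v}" "u < v" for t
  proof -
    have "continuous_on {u..v} (\<lambda>t. w t * h t)"
      using w h by (intro continuous_intros)
    moreover have "integral {u..v} (\<lambda>t. w t * h t) = 0"
      using M True by (simp add: integral_unique)
    ultimately show ?thesis
      using integral_eq_0_iff[of u v "\<lambda>t. w t * h t"] that w h by auto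
  qed
  have "integral {u..v} (\<lambda>t. w t * h t powr p) = 0"
  proof (cases "u < v")
    case True
    have "integral {u..v} (\<lambda>t. w t * h t powr p) = integral {u..v} (\<lambda>t. 0)"
      by (rule integral_cong) (use wh True in fastforce)
    then show ?thesis by simp
  next
    case False
    then show ?thesis
      by (cases "u = v") auto
  qed
  moreover have "0 \<le> W" using has_integral_nonneg[OF W] w by blast
  ultimately show ?thesis by simp
next
  case False
  then have "M > 0" using \<open>0 \<le> M\<close> by auto
  have bound: "((\<lambda>t. M powr p * ((1 - p) * w t + p / M * (w t * h t))) has_integral
      M powr p * ((1 - p) * W + p / M * (W * M))) {u..v}"
    by (intro has_integral_mult_right has_integral_add W M)
  have int: "(\<lambda>t. w t * h t powr p) integrable_on {u..v}"
    using w h p by (intro integrable_continuous_interval continuous_intros continuous_on_powr') auto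
  have "integral {u..v} (\<lambda>t. w t * h t powr p) \<le> M powr p * ((1 - p) * W + p / M * (W * M))"
  proof (rule has_integral_le[OF integrable_integral[OF int] bound])
    fix t assume t: "t \<in> {u..v}"
    have "w t * h t powr p \<le> w t * (M powr p * (1 - p + p * (h t / M)))"
      using powr_le_tangent[of "h t" M p] w h t p \<open>M > 0\<close> by (intro mult_left_mono) auto
    then show "w t * h t powr p \<le> M powr p * ((1 - p) * w t + p / M * (w t * h t))"
      by (simp add: algebra_simps)
  qed
  then show ?thesis using \<open>M > 0\<close> by (simp add: algebra_simps)
qed

section \<open>Moments of the weight\<close>

lemma endpoint_power_moment:
  fixes u v c :: real
  assumes "u \<le> v" "c = u \<or> c = v"
  shows "((\<lambda>t. \<bar>t - c\<bar> ^ n) has_integral (v - u) ^ (n + 1) / (real n + 1)) {u..v}"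
  using assms(2)
proof
  assume c: "c = u"
  have deriv: "((\<lambda>t. (t - u) ^ (n + 1) / (real n + 1)) has_real_derivative (t - u) ^ n)
      (at t within {u..v})" for t
    by (rule derivative_eq_intros refl | simp add: divide_simps)+
  have "((\<lambda>t. (t - u) ^ n) has_integral
      (v - u) ^ (n + 1) / (real n + 1) - (u - u) ^ (n + 1) / (real n + 1)) {u..v}"
    by (rule fundamental_theorem_of_calculus[OF \<open>u \<le> v\<close>])
      (use deriv in \<open>simp add: has_real_derivative_iff_has_vector_derivative\<close>)
  then have "((\<lambda>t. (t - u) ^ n) has_integral (v - u) ^ (n + 1) / (real n + 1)) {u..v}" by simp
  then show ?thesis by (rule has_integral_eq[rotated]) (auto simp: c)
next
  assume c: "c = v"
  have deriv: "((\<lambda>t. - ((v - t) ^ (n + 1) / (real n + 1))) has_real_derivative (v - t) ^ n)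
      (at t within {u..v})" for t
    by (rule derivative_eq_intros refl | simp add: divide_simps)+
  have "((\<lambda>t. (v - t) ^ n) has_integral
      - ((v - v) ^ (n + 1) / (real n + 1)) - - ((v - u) ^ (n + 1) / (real n + 1))) {u..v}"
    by (rule fundamental_theorem_of_calculus[OF \<open>u \<le> v\<close>])
      (use deriv in \<open>simp add: has_real_derivative_iff_has_vector_derivative\<close>)
  then have "((\<lambda>t. (v - t) ^ n) has_integral (v - u) ^ (n + 1) / (real n + 1)) {u..v}" by simp
  then show ?thesis by (rule has_integral_eq[rotated]) (auto simp: c)
qed

text \<open>
  The last factor is the value of the affine function at $(c + (n+1) d)/(n+2)$, the centroid of the
  weight.  Written with the anchor \<open>c\<close> and the far endpoint \<open>d\<close>, it has the same form for both
  choices of the anchor.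
\<close>

lemma endpoint_power_moment_affine:
  fixes u v c d \<alpha> \<beta> :: real
  assumes "u \<le> v" and cd: "c = u \<and> d = v \<or> c = v \<and> d = u"
  shows "((\<lambda>t. \<bar>t - c\<bar> ^ n * (\<alpha> + \<beta> * t)) has_integral
      (v - u) ^ (n + 1) / (real n + 1)
      * (((\<alpha> + \<beta> * c) + (real n + 1) * (\<alpha> + \<beta> * d)) / (real n + 2))) {u..v}"
proof -
  have c: "c = u \<or> c = v" using cd by auto
  define s where "s = (if c = u then 1 else - 1 :: real)"
  define L where "L = v - u"
  have dc: "d = c + s * L" using cd by (auto simp: s_def L_def)
  \<comment> \<open>Expanding the affine function around \<open>c\<close> and using $t - c = s |t - c|$ leaves two pure moments.\<close>
  have "((\<lambda>t. (\<alpha> + \<beta> * c) * \<bar>t - c\<bar> ^ n + \<beta> * s * \<bar>t - c\<bar> ^ (n + 1)) has_integral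
      (\<alpha> + \<beta> * c) * ((v - u) ^ (n + 1) / (real n + 1))
      + \<beta> * s * ((v - u) ^ (n + 1 + 1) / (real (n + 1) + 1))) {u..v}"
    by (intro has_integral_add has_integral_mult_right endpoint_power_moment assms(1) c)
  moreover have "(\<alpha> + \<beta> * c) * \<bar>t - c\<bar> ^ n + \<beta> * s * \<bar>t - c\<bar> ^ (n + 1)
      = \<bar>t - c\<bar> ^ n * (\<alpha> + \<beta> * t)" if "t \<in> {u..v}" for t
  proof -
    have "s * \<bar>t - c\<bar> = t - c" using that c by (auto simp: s_def)
    then have "\<beta> * s * \<bar>t - c\<bar> ^ (n + 1) = \<beta> * (t - c) * \<bar>t - c\<bar> ^ n"
      by (simp add: ac_simps)
    then show ?thesis by (simp add: algebra_simps)
  qed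
  moreover have "(\<alpha> + \<beta> * c) * ((v - u) ^ (n + 1) / (real n + 1))
      + \<beta> * s * ((v - u) ^ (n + 1 + 1) / (real (n + 1) + 1))
      = (v - u) ^ (n + 1) / (real n + 1)
      * (((\<alpha> + \<beta> * c) + (real n + 1) * (\<alpha> + \<beta> * d)) / (real n + 2))"
  proof -
    define N where "N = real n"
    define P where "P = L ^ (n + 1)"
    have nz: "N + 1 \<noteq> 0" "N + 2 \<noteq> 0" by (auto simp: N_def)
    have "(\<alpha> + \<beta> * c) * (P / (N + 1)) + \<beta> * s * (P * L / (N + 2))
        = P / (N + 1) * (((\<alpha> + \<beta> * c) + (N + 1) * (\<alpha> + \<beta> * (c + s * L))) / (N + 2))"
      using nz by (simp add: divide_simps) (simp add: algebra_simps)
    then show ?thesis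
      by (simp add: dc L_def[symmetric] P_def N_def mult.commute add.commute)
  qed
  ultimately show ?thesis
    by (metis (no_types, lifting) has_integral_eq)
qed

section \<open>The estimate on each side of the point\<close>

text \<open>
  This serves twice: with \<open>c = u\<close> to the left of the evaluation point \<open>v\<close>, and with \<open>c = v\<close> to the
  right of the evaluation point \<open>u\<close>.  In both cases the term at \<open>c\<close> of the difference vanishes.
\<close>

lemma anchored_remainder_le:
  fixes D :: "nat \<Rightarrow> real \<Rightarrow> real" and \<alpha> \<beta> :: real
  defines "h \<equiv> (\<lambda>t. \<alpha> + \<beta> * t)"
  assumes "n \<ge> 1" "u \<le> v" and cd: "c = u \<and> d = v \<or> c = v \<and> d = u"
    and D: "\<And>k t. k < n \<Longrightarrow> t \<in> {u..v} \<Longrightarrow>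
              (D k has_real_derivative D (Suc k) t) (at t within {u..v})"
    and p: "0 < p" "p \<le> 1"
    and h0: "\<And>t. t \<in> {u..v} \<Longrightarrow> 0 \<le> h t"
    and Dh: "\<And>t. t \<in> {u..v} \<Longrightarrow> \<bar>D n t\<bar> \<le> h t powr p"
  shows "\<bar>integral {u..v} (D 0) - (anchored_taylor_sum D n c v - anchored_taylor_sum D n c u)\<bar>
    \<le> (v - u) ^ (n + 1) / fact (n + 1) * ((h c + (real n + 1) * h d) / (real n + 2)) powr p"
proof -
  define r where "r = (\<lambda>t. (- 1) ^ n * ((t - c) ^ n / fact n) * D n t)"
  define W where "W = (v - u) ^ (n + 1) / (real n + 1)"
  define M where "M = (h c + (real n + 1) * h d) / (real n + 2)"
  have "continuous_on {u..v} (D 0)"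
    using D[of 0] \<open>n \<ge> 1\<close> by (intro DERIV_continuous_on) auto
  then have D0: "D 0 integrable_on {u..v}"
    by (rule integrable_continuous_interval)
  have "((\<lambda>t. D 0 t - r t) has_integral
      (anchored_taylor_sum D n c v - anchored_taylor_sum D n c u)) {u..v}"
    unfolding r_def
    by (intro fundamental_theorem_of_calculus \<open>u \<le> v\<close>
        has_real_derivative_anchored_taylor_sum D
        has_real_derivative_iff_has_vector_derivative[THEN iffD1])
  \<comment> \<open>Integrability of the remainder \<open>r\<close> is a consequence: \<open>D 0\<close> and \<open>D 0 - r\<close> are integrable.\<close>
  from has_integral_diff[OF integrable_integral[OF D0] this]
  have r: "(r has_integral
      integral {u..v} (D 0) - (anchored_taylor_sum D n c v - anchored_taylor_sum D n c u)) {u..v}"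
    by simp
  have cont_h: "continuous_on {u..v} h"
    unfolding h_def by (intro continuous_intros)
  have cont: "continuous_on {u..v} (\<lambda>t. \<bar>t - c\<bar> ^ n * h t powr p)"
    using h0 p by (intro continuous_intros continuous_on_powr' cont_h) auto
  have "norm (integral {u..v} r) \<le> integral {u..v} (\<lambda>t. 1 / fact n * (\<bar>t - c\<bar> ^ n * h t powr p))"
  proof (rule integral_norm_bound_integral)
    show "r integrable_on {u..v}" using r by blast
    show "(\<lambda>t. 1 / fact n * (\<bar>t - c\<bar> ^ n * h t powr p)) integrable_on {u..v}"
      by (intro integrable_continuous_interval continuous_on_mult_left cont)
    fix t assume "t \<in> {u..v}"
    then have "\<bar>t - c\<bar> ^ n / fact n * \<bar>D n t\<bar> \<le> \<bar>t - c\<bar> ^ n / fact n * h t powr p"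
      by (intro mult_left_mono Dh) auto
    then show "norm (r t) \<le> 1 / fact n * (\<bar>t - c\<bar> ^ n * h t powr p)"
      by (simp add: r_def abs_mult power_abs)
  qed
  also have "\<dots> = 1 / fact n * integral {u..v} (\<lambda>t. \<bar>t - c\<bar> ^ n * h t powr p)"
    by simp
  also have "\<dots> \<le> 1 / fact n * (W * M powr p)"
  proof (intro mult_left_mono integral_powr_mean_le cont_h h0 p)
    show "((\<lambda>t. \<bar>t - c\<bar> ^ n) has_integral W) {u..v}"
      unfolding W_def using cd \<open>u \<le> v\<close> by (intro endpoint_power_moment) auto
    show "((\<lambda>t. \<bar>t - c\<bar> ^ n * h t) has_integral W * M) {u..v}"
      unfolding W_def M_def h_def by (rule endpoint_power_moment_affine[OF \<open>u \<le> v\<close> cd])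
    show "0 \<le> M"
      using h0[of u] h0[of v] cd \<open>u \<le> v\<close> unfolding M_def by auto
  qed (auto intro!: continuous_intros)
  also have "1 / fact n * (W * M powr p) = (v - u) ^ (n + 1) / fact (n + 1) * M powr p"
    by (simp add: W_def field_simps)
  finally show ?thesis
    using integral_unique[OF r] by (simp add: M_def)
qed

lemma powr_bounded_by_chord:
  fixes g :: "real \<Rightarrow> real"
  assumes conv: "convex_on {a..b} (\<lambda>t. \<bar>g t\<bar> powr q)" and "a < b" "q > 0" and t: "t \<in> {a..b}"
  shows "\<bar>g t\<bar> \<le> (((b - t) * \<bar>g a\<bar> powr q + (t - a) * \<bar>g b\<bar> powr q) / (b - a)) powr (1 / q)"
proof -
  define l where "l = (t - a) / (b - a)"
  have l01: "0 \<le> l" "l \<le> 1" and l1: "1 - l = (b - t) / (b - a)"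
    using t \<open>a < b\<close> by (auto simp: l_def field_simps)
  have "(1 - l) * a + l * b = a + l * (b - a)" by (simp add: algebra_simps)
  then have "(1 - l) * a + l * b = t"
    using \<open>a < b\<close> by (simp add: l_def)
  then have "\<bar>g t\<bar> powr q \<le> (1 - l) * \<bar>g a\<bar> powr q + l * \<bar>g b\<bar> powr q"
    using convex_onD[OF conv, of l a b] l01 \<open>a < b\<close> by simp
  also have "\<dots> = ((b - t) * \<bar>g a\<bar> powr q + (t - a) * \<bar>g b\<bar> powr q) / (b - a)"
    by (simp add: l1) (simp add: l_def add_divide_distrib)
  finally have "(\<bar>g t\<bar> powr q) powr (1 / q) \<le>
      (((b - t) * \<bar>g a\<bar> powr q + (t - a) * \<bar>g b\<bar> powr q) / (b - a)) powr (1 / q)"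
    using \<open>q > 0\<close> by (intro powr_mono2) auto
  then show ?thesis using \<open>q > 0\<close> by (simp add: powr_powr)
qed

theorem theorem5:
  fixes n :: nat and q a b x :: real and f :: "real \<Rightarrow> real"
  assumes "n \<ge> 1" and "q \<ge> 1" and "a < b"
    and "times_differentiable_on n f {a..b}"
    and "nth_deriv_within {a..b} n f absolutely_integrable_on {a..b}"
    and "convex_on {a..b} (\<lambda>t. \<bar>nth_deriv_within {a..b} n f t\<bar> powr q)"
    and "x \<in> {a..b}"
  shows "\<bar>integral {a..b} f
            - (\<Sum>k<n. (((b - x) ^ (k + 1) + (- 1) ^ k * (x - a) ^ (k + 1)) / fact (k + 1))
                       * nth_deriv_within {a..b} k f x)\<bar>
    \<le> 1 / (fact (n + 1) * (b - a) powr (1 / q) * (real n + 2) powr (1 / q))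
      * ((x - a) ^ (n + 1)
           * (((real n + 2) * (b - x) + (x - a)) * \<bar>nth_deriv_within {a..b} n f a\<bar> powr q
              + (real n + 1) * (x - a) * \<bar>nth_deriv_within {a..b} n f b\<bar> powr q) powr (1 / q)
         + (b - x) ^ (n + 1)
           * ((real n + 1) * (b - x) * \<bar>nth_deriv_within {a..b} n f a\<bar> powr q
              + ((real n + 2) * (x - a) + (b - x)) * \<bar>nth_deriv_within {a..b} n f b\<bar> powr q)
             powr (1 / q))"
proof -
  define D where "D = (\<lambda>k. nth_deriv_within {a..b} k f)"
  define A where "A = \<bar>D n a\<bar> powr q"
  define B where "B = \<bar>D n b\<bar> powr q"
  define \<alpha> where "\<alpha> = (b * A - a * B) / (b - a)"
  define \<beta> where "\<beta> = (B - A) / (b - a)"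
  define EL where "EL = ((real n + 2) * (b - x) + (x - a)) * A + (real n + 1) * (x - a) * B"
  define ER where "ER = (real n + 1) * (b - x) * A + ((real n + 2) * (x - a) + (b - x)) * B"
  define C where "C = (b - a) powr (1 / q) * (real n + 2) powr (1 / q)"
  have x: "a \<le> x" "x \<le> b" using assms(7) by auto
  have AB: "0 \<le> A" "0 \<le> B" by (auto simp: A_def B_def)
  have p: "0 < 1 / q" "1 / q \<le> 1" using assms(2) by auto
  have h: "\<alpha> + \<beta> * t = ((b - t) * A + (t - a) * B) / (b - a)" for t
    using assms(3) by (simp add: \<alpha>_def \<beta>_def divide_simps) (simp add: algebra_simps)
  have h0: "0 \<le> \<alpha> + \<beta> * t" if "t \<in> {a..b}" for t
    using that AB assms(3) by (auto simp: h)
  have Dh: "\<bar>D n t\<bar> \<le> (\<alpha> + \<beta> * t) powr (1 / q)" if "t \<in> {a..b}" for t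
    unfolding h A_def B_def using assms(2,3,6) that
    by (intro powr_bounded_by_chord) (auto simp: D_def)
  have D: "(D k has_real_derivative D (Suc k) t) (at t within {u..v})"
    if "k < n" "t \<in> {u..v}" "{u..v} \<subseteq> {a..b}" for k t u v
    using nth_deriv_within_has_real_derivative[OF assms(4), of k t] that
    by (auto simp: D_def intro: DERIV_subset)
  have left: "\<bar>integral {a..x} (D 0) - anchored_taylor_sum D n a x\<bar>
      \<le> (x - a) ^ (n + 1) / fact (n + 1)
        * ((\<alpha> + \<beta> * a + (real n + 1) * (\<alpha> + \<beta> * x)) / (real n + 2)) powr (1 / q)"
    using anchored_remainder_le[of n a x a x D "1 / q" \<alpha> \<beta>] assms(1) x p
    by (simp add: D h0 Dh)
  have right: "\<bar>integral {x..b} (D 0) + anchored_taylor_sum D n b x\<bar>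
      \<le> (b - x) ^ (n + 1) / fact (n + 1)
        * ((\<alpha> + \<beta> * b + (real n + 1) * (\<alpha> + \<beta> * x)) / (real n + 2)) powr (1 / q)"
    using anchored_remainder_le[of n x b b x D "1 / q" \<alpha> \<beta>] assms(1) x p
    by (simp add: D h0 Dh)
  have mean_left: "(\<alpha> + \<beta> * a + (real n + 1) * (\<alpha> + \<beta> * x)) / (real n + 2)
      = EL / ((b - a) * (real n + 2))"
    unfolding h EL_def using assms(3) by (simp add: divide_simps) (simp add: algebra_simps)
  have mean_right: "(\<alpha> + \<beta> * b + (real n + 1) * (\<alpha> + \<beta> * x)) / (real n + 2)
      = ER / ((b - a) * (real n + 2))"
    unfolding h ER_def using assms(3) by (simp add: divide_simps) (simp add: algebra_simps)
  have powr_C: "(E / ((b - a) * (real n + 2))) powr (1 / q) = E powr (1 / q) / C" if "0 \<le> E" for E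
    using that assms(3) by (simp add: C_def powr_divide powr_mult)
  have E0: "0 \<le> EL" "0 \<le> ER" using AB x by (auto simp: EL_def ER_def)
  have sums: "(\<Sum>k<n. (((b - x) ^ (k + 1) + (- 1) ^ k * (x - a) ^ (k + 1)) / fact (k + 1)) * D k x)
      = anchored_taylor_sum D n a x - anchored_taylor_sum D n b x"
  proof -
    have distrib: "(- (s * P) + s * Q) / F * d = s * (Q / F) * d - s * (P / F) * d"
      for s P Q F d :: real
      by (simp add: diff_divide_distrib algebra_simps)
    have minus: "(b - x) ^ (k + 1) = - ((- 1) ^ k * (x - b) ^ (k + 1))" for k
      using power_minus[of "x - b" "k + 1"] by simp
    show ?thesis
      unfolding anchored_taylor_sum_def sum_subtractf[symmetric] minus
      by (intro sum.cong refl distrib)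
  qed
  have "D 0 integrable_on {a..b}"
    using D[of 0 _ a b] assms(1)
    by (intro integrable_continuous_interval DERIV_continuous_on) auto
  then have split: "integral {a..b} (D 0) = integral {a..x} (D 0) + integral {x..b} (D 0)"
    using Henstock_Kurzweil_Integration.integral_combine[OF x, of "D 0"] by simp
  have "\<bar>integral {a..b} (D 0) - (\<Sum>k<n. (((b - x) ^ (k + 1) + (- 1) ^ k * (x - a) ^ (k + 1))
      / fact (k + 1)) * D k x)\<bar>
      \<le> (x - a) ^ (n + 1) / fact (n + 1) * (EL powr (1 / q) / C)
        + (b - x) ^ (n + 1) / fact (n + 1) * (ER powr (1 / q) / C)"
    using left right unfolding sums split mean_left mean_right powr_C[OF E0(1)] powr_C[OF E0(2)]
    by linarith
  also have "\<dots> = 1 / (fact (n + 1) * C)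
      * ((x - a) ^ (n + 1) * EL powr (1 / q) + (b - x) ^ (n + 1) * ER powr (1 / q))"
    by (simp add: distrib_left mult.commute[of C] del: fact_Suc power_Suc)
  finally show ?thesis
    by (simp add: D_def A_def B_def C_def EL_def ER_def mult.assoc del: fact_Suc)
qed

end
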